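(* Let $r$ be a positive integer and let $n,k$ be non-negative integers. The number of partitions of the set $[n]=\{1,\ldots,n\}$ into $k$ blocks of cardinality $1$ modulo $r$ is given by $$\frac{1}{k!}\cdot F_{r}^{k}(x^{n})\Big|_{x=0}.$$
   Context: Let $\omega=e^{2\pi i/r}$ be a primitive $r$th root of unity. For a complex number $a$, the shift operator $E^{a}$ on polynomials is $E^{a}(p(x))=p(x+a)$. The fast Fourier operator $F_r$ is the operator on polynomials in $x$ given by $$F_{r}=\frac{1}{r}\cdot\sum_{j=0}^{r-1}\omega^{-j}\cdot E^{\omega^{j}},$$ and $F_r^k$ is its $k$-fold iterate. The blocks of a set partition are non-empty, and each of the $k$ blocks is required to have cardinality congruent to $1$ modulo $r$.
   Formalization: The formal theorem takes r ≥ 2 instead of any positive integer r: for r = 1 the formula gives k^n/k!, which is wrong for every k ≥ 2 (for n = 1, k = 3 it gives 1/2, while the count is 0). *)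

theory Defs
  imports
    Complex_Main
    "HOL-Library.Disjoint_Sets"
    "HOL-Computational_Algebra.Polynomial"
    "HOL-Number_Theory.Cong"
begin

definition shift_op :: "complex \<Rightarrow> complex poly \<Rightarrow> complex poly"
  where "shift_op a p = pcompose p [:a, 1:]"

definition unity_root :: "nat \<Rightarrow> complex"
  where "unity_root r = exp (2 * of_real pi * \<i> / of_nat r)"

definition fft_op :: "nat \<Rightarrow> complex poly \<Rightarrow> complex poly"
  where "fft_op r p =
    smult (1 / of_nat r)
      (\<Sum>j<r. smult (unity_root r powi (- int j)) (shift_op (unity_root r ^ j) p))"

definition partitions_1_mod :: "nat \<Rightarrow> nat \<Rightarrow> nat \<Rightarrow> nat set set set"
  where "partitions_1_mod r n k =
    {P. partition_on {1..n} P \<and> card P = k \<and> (\<forall>B\<in>P. [card B = 1] (mod r))}"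

text \<open>
  The identity between the number of these partitions and the value of the iterated operator at 0
  is restricted to \<open>r \<ge> 2\<close>. For \<open>r = 1\<close> the operator is the unit shift, so the formula gives
  \<open>k ^ n / k!\<close>: this counts all maps to \<open>k\<close> labelled blocks, including those leaving some block
  empty, and it need not be an integer. For \<open>r \<ge> 2\<close> the empty set does not have cardinality
  1 modulo \<open>r\<close>, so the discrepancy does not arise. The next lemma records the failure.
\<close>

lemma fft_formula_fails_for_1:
  "of_nat (card (partitions_1_mod 1 1 3)) \<noteq>
    1 / fact 3 * poly ((fft_op 1 ^^ 3) (monom 1 1)) 0"
proof -
  have u: "unity_root (Suc 0) = 1"
    using exp_two_pi_i' by (simp add: unity_root_def)
  have v: "1 / fact 3 * poly ((fft_op 1 ^^ 3) (monom 1 1)) 0 = 1 / (2 :: complex)"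
    by (simp add: fft_op_def shift_op_def u eval_nat_numeral monom_Suc poly_pcompose fact_numeral pcompose_pCons)
  have "of_nat m \<noteq> 1 / (2 :: complex)" for m
  proof
    assume "of_nat m = 1 / (2 :: complex)"
    then have "of_nat (2 * m) = (of_nat 1 :: complex)" by (simp add: mult.commute)
    then have "2 * m = 1" by (simp only: of_nat_eq_iff)
    then show False by presburger
  qed
  then show ?thesis unfolding v by blast
qed

end

theory Submission
  imports Defs "HOL-Analysis.Complex_Transcendental"
begin

text \<open>
  Averaging over the \<open>r\<close>th roots of unity keeps exactly the terms
  \<open>(n choose i) x ^ (n - i)\<close> of \<open>(x + \<omega> ^ j) ^ n\<close> with \<open>i\<close> congruent to 1 modulo \<open>r\<close>.
  Applied to \<open>x ^ n\<close>, the operator thus removes a block of admissible size from an \<open>n\<close>-element set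
  in all possible ways. Iterating \<open>k\<close> times and evaluating at 0 counts the ways to remove \<open>k\<close> blocks
  that exhaust the set, that is, the partitions together with an ordering of their \<open>k\<close> blocks.
\<close>

text \<open>The carrier is arbitrary because deleting a block from an interval need not leave an
  interval.\<close>

definition sized_partitions :: "nat set \<Rightarrow> 'a set \<Rightarrow> nat \<Rightarrow> 'a set set set"
  where "sized_partitions S A k = {P. partition_on A P \<and> card P = k \<and> card ` P \<subseteq> S}"

lemma finite_sized_partitions: "finite A \<Longrightarrow> finite (sized_partitions S A k)"
  unfolding sized_partitions_def
  by (rule finite_subset[OF _ finitely_many_partition_on[of A]]) auto

lemma card_sized_partitions_0:
  assumes "finite A"
  shows "card (sized_partitions S A 0) = (if A = {} then 1 else 0)"
proof -
  \<comment> \<open>Finiteness matters: \<open>card\<close> is 0 on infinite families too, but a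
    partition of a finite set is finite.\<close>
  have "sized_partitions S A 0 = (if A = {} then {{}} else {})"
    using assms by (auto simp: sized_partitions_def partition_on_def finite_UnionD)
  then show ?thesis by simp
qed

text \<open>Double counting of partitions with one marked block.\<close>

lemma card_sized_partitions_Suc:
  assumes "finite A" and "0 \<notin> S"
  shows "Suc k * card (sized_partitions S A (Suc k)) =
    (\<Sum>B | B \<subseteq> A \<and> card B \<in> S. card (sized_partitions S (A - B) k))"
proof -
  let ?L = "SIGMA B:{B. B \<subseteq> A \<and> card B \<in> S}. sized_partitions S (A - B) k"
  let ?R = "SIGMA P:sized_partitions S A (Suc k). P"
  have insert: "insert B Q \<in> sized_partitions S A (Suc k) \<and> B \<notin> Q"
    if "B \<subseteq> A" "card B \<in> S" "Q \<in> sized_partitions S (A - B) k" for B Q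
  proof -
    have Q: "partition_on (A - B) Q" "card Q = k" "card ` Q \<subseteq> S"
      using that(3) by (auto simp: sized_partitions_def)
    \<comment> \<open>Here \<open>0 \<notin> S\<close> enters: an empty B could be chosen on the
      right-hand side but never be a block.\<close>
    have "B \<noteq> {}" using that(2) assms(2) by auto
    moreover have "disjnt B (\<Union>Q)"
      using partition_onD1[OF Q(1)] by (auto simp: disjnt_def)
    ultimately have "partition_on A (insert B Q)" "B \<notin> Q"
      using Q(1) that(1) by (auto simp: partition_on_insert disjnt_def)
    moreover have "finite Q"
      using finite_elements[OF _ Q(1)] assms(1) by auto
    ultimately show ?thesis
      using Q that(2) by (auto simp: sized_partitions_def)
  qed
  have remove: "B \<subseteq> A \<and> card B \<in> S \<and> P - {B} \<in> sized_partitions S (A - B) k"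
    if "P \<in> sized_partitions S A (Suc k)" "B \<in> P" for B P
  proof -
    have P: "partition_on A P" "card P = Suc k" "card ` P \<subseteq> S"
      using that(1) by (auto simp: sized_partitions_def)
    have "disjnt B (\<Union>(P - {B}))"
      using partition_onD2[OF P(1)] that(2) by (fastforce simp: disjnt_def disjoint_def)
    moreover have "partition_on A (insert B (P - {B}))"
      using P(1) that(2) by (simp add: insert_absorb)
    ultimately have "partition_on (A - B) (P - {B})" "B \<subseteq> A"
      using partition_on_insert by blast+
    then show ?thesis
      using P that(2) by (auto simp: sized_partitions_def)
  qed
  \<comment> \<open>The marked block is split off from the partition of the rest. Fibres over B give
    the sum; fibres over P have \<open>Suc k\<close> elements each.\<close>
  have "bij_betw (\<lambda>(B, Q). (insert B Q, B)) ?L ?R"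
  proof (rule bij_betw_byWitness[where f' = "\<lambda>(P, B). (B, P - {B})"])
    show "\<forall>x\<in>?L. (\<lambda>(P, B). (B, P - {B})) ((\<lambda>(B, Q). (insert B Q, B)) x) = x"
      using insert by fastforce
    show "\<forall>x\<in>?R. (\<lambda>(B, Q). (insert B Q, B)) ((\<lambda>(P, B). (B, P - {B})) x) = x"
      by auto
    show "(\<lambda>(B, Q). (insert B Q, B)) ` ?L \<subseteq> ?R"
      using insert by fastforce
    show "(\<lambda>(P, B). (B, P - {B})) ` ?R \<subseteq> ?L"
      using remove by fastforce
  qed
  then have "card ?L = card ?R"
    by (rule bij_betw_same_card)
  moreover have "card ?L = (\<Sum>B | B \<subseteq> A \<and> card B \<in> S. card (sized_partitions S (A - B) k))"
    using assms(1) by (intro card_SigmaI) (auto intro: finite_sized_partitions)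
  moreover have "card ?R = (\<Sum>P\<in>sized_partitions S A (Suc k). card P)"
  proof (rule card_SigmaI)
    show "\<forall>P\<in>sized_partitions S A (Suc k). finite P"
      using finite_elements[OF assms(1)] by (auto simp: sized_partitions_def)
  qed (rule finite_sized_partitions[OF assms(1)])
  moreover have "\<dots> = Suc k * card (sized_partitions S A (Suc k))"
    by (simp add: sized_partitions_def)
  ultimately show ?thesis by simp
qed

text \<open>Turns a sum over removed blocks into the binomial sum that the operator
  produces.\<close>

lemma sum_Pow_card:
  fixes f :: "nat \<Rightarrow> 'b::comm_semiring_1"
  assumes "finite A"
  shows "(\<Sum>B\<in>Pow A. f (card B)) = (\<Sum>i\<le>card A. of_nat (card A choose i) * f i)"
proof -
  have "(\<Sum>B\<in>Pow A. f (card B)) = (\<Sum>i\<le>card A. \<Sum>B | B \<in> Pow A \<and> card B = i. f (card B))"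
    using assms by (intro sum.group[symmetric]) (auto intro: card_mono)
  also have "\<dots> = (\<Sum>i\<le>card A. of_nat (card A choose i) * f i)"
    using assms by (simp add: n_subsets)
  finally show ?thesis .
qed

lemma smult_sum_right:
  fixes p :: "'i \<Rightarrow> 'a::comm_semiring_0 poly"
  shows "smult c (\<Sum>i\<in>I. p i) = (\<Sum>i\<in>I. smult c (p i))"
  by (induction I rule: infinite_finite_induct) (simp_all add: smult_add_right)

lemma pcompose_monom:
  fixes q :: "'a::comm_semiring_1 poly"
  shows "pcompose (monom c n) q = smult c (q ^ n)"
  by (induction n) (simp_all add: monom_0 monom_Suc pcompose_pCons)

lemma shift_op_monom:
  "shift_op a (monom 1 n) = (\<Sum>i\<le>n. monom (of_nat (n choose i) * a ^ i) (n - i))"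
proof -
  have "shift_op a (monom 1 n) = ([:a:] + monom 1 1) ^ n"
    by (simp add: shift_op_def pcompose_monom monom_Suc monom_0)
  also have "\<dots> = (\<Sum>i\<le>n. monom (of_nat (n choose i) * a ^ i) (n - i))"
    unfolding binomial_ring
    by (simp add: of_nat_poly poly_const_pow monom_power smult_monom mult.commute)
  finally show ?thesis .
qed

text \<open>A geometric sum with ratio \<omega>^(i-1), an rth root of unity: it vanishes unless the
  ratio is 1.\<close>

lemma sum_unity_root:
  assumes "r > 0"
  shows "(\<Sum>j<r. unity_root r powi (- int j) * (unity_root r ^ j) ^ i) =
    (if [i = 1] (mod r) then of_nat r else 0)"
proof -
  let ?w = "unity_root r"
  \<comment> \<open>The quotient form also covers i = 0, where truncated subtraction would give the
    wrong exponent.\<close>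
  let ?z = "?w ^ i / ?w"
  have w0: "?w \<noteq> 0" by (simp add: unity_root_def)
  have pow: "?w ^ j = exp (2 * of_real pi * \<i> * of_nat j / of_nat r)" for j
    by (simp add: unity_root_def exp_of_nat_mult[symmetric] field_simps)
  have w1: "?w ^ r = 1"
    using complex_root_unity[of r 1] assms by (simp add: unity_root_def)
  have "?z = 1 \<longleftrightarrow> ?w ^ i = ?w ^ 1"
    using w0 by simp
  also have "\<dots> \<longleftrightarrow> [i = 1] (mod r)"
    unfolding pow cong_def using assms by (intro complex_root_unity_eq) simp
  finally have z: "?z = 1 \<longleftrightarrow> [i = 1] (mod r)" .
  have "?z ^ r = (?w ^ r) ^ i / ?w ^ r"
    by (simp add: power_divide mult.commute flip: power_mult)
  then have zr: "?z ^ r = 1" by (simp add: w1)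
  have "(\<Sum>j<r. ?w powi (- int j) * (?w ^ j) ^ i) = (\<Sum>j<r. ?z ^ j)"
    by (intro sum.cong)
      (simp_all add: power_int_minus power_divide mult.commute inverse_eq_divide flip: power_mult)
  also have "\<dots> = (if [i = 1] (mod r) then of_nat r else 0)"
    using z zr by (simp add: sum_gp_strict)
  finally show ?thesis .
qed

text \<open>Exchanging the sums leaves the root-of-unity filter as the coefficient for each i.
  Scalars stay outside the monic monomials so that linearity of the iterates applies
  directly.\<close>

lemma fft_op_monom:
  assumes "r > 0"
  shows "fft_op r (monom 1 n) =
    (\<Sum>i\<le>n. smult (if [i = 1] (mod r) then of_nat (n choose i) else 0) (monom 1 (n - i)))"
proof -
  let ?w = "unity_root r"
  have "fft_op r (monom 1 n) =
    smult (1 / of_nat r) (\<Sum>i\<le>n. \<Sum>j<r.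
      smult (of_nat (n choose i) * (?w powi (- int j) * (?w ^ j) ^ i)) (monom 1 (n - i)))"
    unfolding fft_op_def shift_op_monom
    by (subst sum.swap) (simp add: smult_sum_right smult_monom ac_simps)
  also have "\<dots> = (\<Sum>i\<le>n. smult (1 / of_nat r * (of_nat (n choose i) *
      (\<Sum>j<r. ?w powi (- int j) * (?w ^ j) ^ i))) (monom 1 (n - i)))"
    by (simp add: smult_sum_right smult_sum sum_distrib_left)
  also have "\<dots> = (\<Sum>i\<le>n. smult (if [i = 1] (mod r) then of_nat (n choose i) else 0) (monom 1 (n - i)))"
    unfolding sum_unity_root[OF assms] using assms by (intro sum.cong) auto
  finally show ?thesis .
qed

lemma fft_op_sum_smult:
  "fft_op r (\<Sum>i\<in>I. smult (c i) (p i)) = (\<Sum>i\<in>I. smult (c i) (fft_op r (p i)))"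
proof -
  have "fft_op r (\<Sum>i\<in>I. smult (c i) (p i)) =
    (\<Sum>j<r. \<Sum>i\<in>I. smult (1 / of_nat r) (smult (unity_root r powi (- int j))
      (smult (c i) (shift_op (unity_root r ^ j) (p i)))))"
    by (simp only: fft_op_def shift_op_def pcompose_sum pcompose_smult smult_sum_right)
  also have "\<dots> = (\<Sum>i\<in>I. smult (c i) (fft_op r (p i)))"
    by (subst sum.swap) (simp add: fft_op_def smult_sum_right mult_ac)
  finally show ?thesis .
qed

lemma fft_op_funpow_sum_smult:
  "(fft_op r ^^ k) (\<Sum>i\<in>I. smult (c i) (p i)) = (\<Sum>i\<in>I. smult (c i) ((fft_op r ^^ k) (p i)))"
  by (induction k) (simp_all add: fft_op_sum_smult)

text \<open>With the denominator cleared, \<open>fact (Suc k)\<close> supplies the factor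
  \<open>Suc k\<close> of the double count. The set varies in the induction, which passes from A to
  A - B.\<close>

lemma fact_card_sized_partitions:
  fixes A :: "'a set"
  assumes "r \<ge> 2" and "finite A"
  shows "fact k * of_nat (card (sized_partitions {i. [i = 1] (mod r)} A k)) =
    poly ((fft_op r ^^ k) (monom 1 (card A))) 0"
  using assms(2)
proof (induction k arbitrary: A)
  case 0
  \<comment> \<open>Both sides are 1 for empty A, where \<open>0 ^ 0 = 1\<close>, and 0
    otherwise.\<close>
  then show ?case by (simp add: card_sized_partitions_0 poly_monom power_0_left card_gt_0_iff)
next
  case (Suc k)
  let ?S = "{i. [i = 1] (mod r)}"
  let ?f = "\<lambda>m. poly ((fft_op r ^^ k) (monom 1 m)) 0"
  \<comment> \<open>For r = 1 this fails, since 0 and 1 are then congruent.\<close>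
  have S: "0 \<notin> ?S" using assms(1) by (auto simp: cong_def)
  have "fact (Suc k) * of_nat (card (sized_partitions ?S A (Suc k))) =
    (fact k * of_nat (Suc k * card (sized_partitions ?S A (Suc k))) :: complex)"
    by (simp add: algebra_simps)
  also have "\<dots> = (\<Sum>B | B \<subseteq> A \<and> card B \<in> ?S.
      fact k * of_nat (card (sized_partitions ?S (A - B) k)))"
    unfolding card_sized_partitions_Suc[OF Suc.prems S] by (simp add: sum_distrib_left)
  also have "\<dots> = (\<Sum>B | B \<subseteq> A \<and> card B \<in> ?S. ?f (card A - card B))"
    using Suc.prems by (intro sum.cong) (auto simp: Suc.IH card_Diff_subset finite_subset simp del: One_nat_def)
  \<comment> \<open>Zero terms extend the sum to all subsets, ready for grouping by
    cardinality.\<close>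
  also have "\<dots> = (\<Sum>B\<in>Pow A. if [card B = 1] (mod r) then ?f (card A - card B) else 0)"
    using Suc.prems by (intro sum.mono_neutral_cong_left) auto
  also have "\<dots> = (\<Sum>i\<le>card A. of_nat (card A choose i) *
      (if [i = 1] (mod r) then ?f (card A - i) else 0))"
    using sum_Pow_card[OF Suc.prems, of "\<lambda>i. if [i = 1] (mod r) then ?f (card A - i) else 0"] .
  \<comment> \<open>The binomial sum is the innermost application of the operator, carried through
    the other k by linearity.\<close>
  also have "\<dots> = poly ((fft_op r ^^ k) (fft_op r (monom 1 (card A)))) 0"
    using assms(1)
    by (auto simp: fft_op_monom fft_op_funpow_sum_smult poly_sum intro!: sum.cong)
  finally show ?case by (simp add: funpow_swap1)
qed

theorem proposition6p3:
  fixes r n k :: nat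
  assumes "r \<ge> 2"
  shows "of_nat (card (partitions_1_mod r n k)) =
    1 / fact k * poly ((fft_op r ^^ k) (monom 1 n)) 0"
proof -
  have "partitions_1_mod r n k = sized_partitions {i. [i = 1] (mod r)} {1..n} k"
    by (auto simp: partitions_1_mod_def sized_partitions_def)
  then show ?thesis
    using fact_card_sized_partitions[OF assms, of "{1..n}" k]
    by (simp add: field_simps)
qed

end
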